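(* Let $F:\mathbb{R}^d\to\mathbb{R}$ be twice continuously differentiable, bounded below by a scalar $\widehat F$, and have $L$-Lipschitz continuous gradient on $\mathbb{R}^d$. Let $\epsilon>0$ and let $\{w_k\}$ be the iterates generated from the starting point $w_0$ by the sampled LBFGS (S-LBFGS) method, $w_{k+1}=w_k-\alpha_kH_k\nabla F(w_k)$, with the modification that the inverse Hessian approximation update is performed using only curvature pairs that satisfy $s^Ty>\epsilon\|s\|^2$, and $H_k=I$ if no curvature pairs satisfy this condition. Let $0<\mu_1\le\mu_2$ be constants such that $\mu_1I\preceq H_k\preceq\mu_2I$ for all $k=0,1,2,\dots$, and suppose that $$0<\alpha_k=\alpha\le\frac{\mu_1}{\mu_2^2L}.$$ Then $$\lim_{k\to\infty}\|\nabla F(w_k)\|=0,$$ and, moreover, for any $T>1$, $$\frac1T\sum_{k=0}^{T-1}\|\nabla F(w_k)\|^2\le\frac{2[F(w_0)-\widehat F]}{\alpha\mu_1T}\xrightarrow[T\to\infty]{}0.$$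
   Context: S-LBFGS method with memory $m\ge 1$, sampling radius $r>0$ and cautious updating. At iteration $k$, given $w_k$: for $j=1,\dots,m$ sample a (nonzero, otherwise arbitrary) random direction $\sigma_j\in\mathbb{R}^d$, set $\bar w_j=w_k+r\sigma_j$, $s=w_k-\bar w_j$, and either $y=\nabla F(w_k)-\nabla F(\bar w_j)$ (Option I) or $y=\nabla^2F(w_k)s$ (Option II); the results hold for both options. Keep only the pairs with $s^Ty>\epsilon\|s\|^2$, and denote them $(s_{k,i},y_{k,i})$, $i=1,\dots,\tilde m_k$. If $\tilde m_k=0$, set $H_k=I$. Otherwise $H_k=B_k^{-1}$ where $B_k=B_k^{(\tilde m_k)}$ is obtained from $B_k^{(0)}=\frac{y_{k,l}^Ty_{k,l}}{s_{k,l}^Ty_{k,l}}I$ (with $l$ chosen uniformly at random from $\{1,\dots,\tilde m_k\}$) by the updates, for $i=1,\dots,\tilde m_k$, $$B_k^{(i)}=B_k^{(i-1)}-\frac{B_k^{(i-1)}s_{k,i}s_{k,i}^TB_k^{(i-1)}}{s_{k,i}^TB_k^{(i-1)}s_{k,i}}+\frac{y_{k,i}y_{k,i}^T}{y_{k,i}^Ts_{k,i}}.$$ $T$ is an integer. $A\preceq B$ means $B-A$ is positive semidefinite. Constants $\mu_1,\mu_2$ as in the claim are known to exist under the stated hypotheses on $F$. *)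

theory Defs
  imports "HOL-Analysis.Analysis"
begin

definition grad :: "(real^'n \<Rightarrow> real) \<Rightarrow> real^'n \<Rightarrow> real^'n" where
  "grad F x = (\<chi> i. frechet_derivative F (at x) (axis i 1))"

definition hess :: "(real^'n \<Rightarrow> real) \<Rightarrow> real^'n \<Rightarrow> real^'n^'n" where
  "hess F x = jacobian (grad F) (at x)"

definition twice_continuously_differentiable :: "(real^'n \<Rightarrow> real) \<Rightarrow> bool" where
  "twice_continuously_differentiable F \<longleftrightarrow>
     (\<forall>x. F differentiable (at x)) \<and>
     (\<forall>x. grad F differentiable (at x)) \<and>
     continuous_on UNIV (hess F)"

definition positive_semidefinite :: "real^'n^'n \<Rightarrow> bool" where
  "positive_semidefinite A \<longleftrightarrow> transpose A = A \<and> (\<forall>x. 0 \<le> x \<bullet> (A *v x))"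

definition loewner_le :: "real^'n^'n \<Rightarrow> real^'n^'n \<Rightarrow> bool" (infix "\<preceq>" 50) where
  "A \<preceq> B \<longleftrightarrow> positive_semidefinite (B - A)"

definition outer :: "real^'n \<Rightarrow> real^'n \<Rightarrow> real^'n^'n" where
  "outer u v = (\<chi> i j. u $ i * v $ j)"

datatype pair_rule = Option_I | Option_II

fun sample_pair ::
  "pair_rule \<Rightarrow> (real^'n \<Rightarrow> real) \<Rightarrow> real \<Rightarrow> real^'n \<Rightarrow> real^'n \<Rightarrow> (real^'n) \<times> (real^'n)" where
  "sample_pair Option_I F r w d =
     (let w' = w + r *\<^sub>R d; s = w - w' in (s, grad F w - grad F w'))"
| "sample_pair Option_II F r w d =
     (let w' = w + r *\<^sub>R d; s = w - w' in (s, hess F w *v s))"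

definition curvature_pairs ::
  "pair_rule \<Rightarrow> (real^'n \<Rightarrow> real) \<Rightarrow> nat \<Rightarrow> real \<Rightarrow> real \<Rightarrow> (nat \<Rightarrow> real^'n) \<Rightarrow> real^'n
     \<Rightarrow> ((real^'n) \<times> (real^'n)) list" where
  "curvature_pairs opt F m r \<epsilon> d w =
     filter (\<lambda>(s, y). s \<bullet> y > \<epsilon> * (norm s)\<^sup>2) (map (\<lambda>j. sample_pair opt F r w (d j)) [1..<m+1])"

definition bfgs_update :: "real^'n^'n \<Rightarrow> (real^'n) \<times> (real^'n) \<Rightarrow> real^'n^'n" where
  "bfgs_update B p = (case p of (s, y) \<Rightarrow>
     B - (1 / (s \<bullet> (B *v s))) *\<^sub>R (B ** outer s s ** B) + (1 / (y \<bullet> s)) *\<^sub>R outer y y)"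

definition bfgs_init :: "(real^'n) \<times> (real^'n) \<Rightarrow> real^'n^'n" where
  "bfgs_init p = (case p of (s, y) \<Rightarrow> mat ((y \<bullet> y) / (s \<bullet> y)))"

(* l is the 0-based position of the pair used for the initial scaling. *)
definition slbfgs_H ::
  "pair_rule \<Rightarrow> (real^'n \<Rightarrow> real) \<Rightarrow> nat \<Rightarrow> real \<Rightarrow> real \<Rightarrow> (nat \<Rightarrow> real^'n) \<Rightarrow> nat \<Rightarrow> real^'n
     \<Rightarrow> real^'n^'n" where
  "slbfgs_H opt F m r \<epsilon> d l w =
     (let ps = curvature_pairs opt F m r \<epsilon> d w in
      if ps = [] then mat 1 else matrix_inv (foldl bfgs_update (bfgs_init (ps ! l)) ps))"

(* w is a run of S-LBFGS with step sizes a for the outcome (\<sigma>, l) of the random choices: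
   \<sigma> k 1, ..., \<sigma> k m are the directions drawn at iteration k and l k the index drawn for the
   initial scaling. Only the admissible outcomes are described, so a statement about all runs
   holds for every realization, whatever the distribution of the random choices. *)
definition slbfgs_run ::
  "pair_rule \<Rightarrow> (real^'n \<Rightarrow> real) \<Rightarrow> nat \<Rightarrow> real \<Rightarrow> real \<Rightarrow> (nat \<Rightarrow> real) \<Rightarrow>
   (nat \<Rightarrow> nat \<Rightarrow> real^'n) \<Rightarrow> (nat \<Rightarrow> nat) \<Rightarrow> (nat \<Rightarrow> real^'n) \<Rightarrow> bool" where
  "slbfgs_run opt F m r \<epsilon> a \<sigma> l w \<longleftrightarrow>
     (\<forall>k. (\<forall>j\<in>{1..m}. \<sigma> k j \<noteq> 0) \<and>
          (let ps = curvature_pairs opt F m r \<epsilon> (\<sigma> k) (w k) in ps \<noteq> [] \<longrightarrow> l k < length ps) \<and>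
          w (Suc k) = w k - a k *\<^sub>R (slbfgs_H opt F m r \<epsilon> (\<sigma> k) (l k) (w k) *v grad F (w k)))"

end

theory Submission
  imports Defs
begin

text \<open>
  The descent lemma for an \<open>L\<close>-smooth function, applied to the step \<open>-\<alpha> H g\<close> with \<open>g\<close> the gradient
  at the iterate, gives
  \<open>F (w k) - F (w (k + 1)) \<ge> \<alpha> (\<mu>\<^sub>1 - \<alpha> L \<mu>\<^sub>2\<^sup>2 / 2) \<parallel>g\<parallel>\<^sup>2 \<ge> (\<alpha> \<mu>\<^sub>1 / 2) \<parallel>g\<parallel>\<^sup>2\<close>:
  only the eigenvalue bounds on \<open>H\<close> matter, not how it was built. Summing and telescoping against
  the lower bound of \<open>F\<close> bounds the sum of the squared gradient norms.
\<close>

text \<open>A derivative is linear, hence fixed by its values on the vectors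
  \<open>axis i 1\<close>, and these values are the entries of \<open>grad F x\<close>.\<close>

lemma grad_has_derivative:
  assumes "F differentiable (at x)"
  shows "(F has_derivative (\<lambda>h. grad F x \<bullet> h)) (at x)"
proof -
  let ?D = "frechet_derivative F (at x)"
  have D: "(F has_derivative ?D) (at x)"
    using assms frechet_derivative_works by blast
  then have lin: "linear ?D"
    by (rule has_derivative_linear)
  have "?D h = grad F x \<bullet> h" for h
  proof -
    have "?D h = ?D (\<Sum>i\<in>UNIV. (h $ i) *\<^sub>R axis i 1)"
      using basis_expansion[of h] by (simp add: scalar_mult_eq_scaleR)
    also have "\<dots> = (\<Sum>i\<in>UNIV. (h $ i) * ?D (axis i 1))"
      by (simp add: linear_sum[OF lin] linear_scale[OF lin])
    also have "\<dots> = grad F x \<bullet> h"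
      by (simp add: grad_def inner_vec_def mult.commute)
    finally show ?thesis .
  qed
  then show ?thesis
    using D by (metis ext)
qed

text \<open>On the segment from \<open>x\<close> to \<open>x + h\<close> this is a monotonicity
  statement in one real variable: the Lipschitz bound and Cauchy-Schwarz keep the slope of
  \<open>F\<close> below that of the quadratic model.\<close>

lemma descent_lemma:
  fixes F :: "real^'n \<Rightarrow> real"
  assumes diff: "\<And>x. F differentiable (at x)" and lip: "L-lipschitz_on UNIV (grad F)"
  shows "F (x + h) \<le> F x + grad F x \<bullet> h + L / 2 * (norm h)\<^sup>2"
proof -
  \<comment> \<open>\<open>\<phi>\<close> is \<open>F\<close> along the segment minus the
    non-constant part of the quadratic model, so the claim is exactly
    \<open>\<phi> 1 \<le> \<phi> 0\<close>.\<close>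
  define \<phi> where "\<phi> t = F (x + t *\<^sub>R h) - t * (grad F x \<bullet> h) - L / 2 * t\<^sup>2 * (norm h)\<^sup>2" for t
  define \<phi>' where "\<phi>' t = grad F (x + t *\<^sub>R h) \<bullet> h - grad F x \<bullet> h - L * t * (norm h)\<^sup>2" for t
  have deriv: "(\<phi> has_real_derivative \<phi>' t) (at t)" for t
  proof -
    have "((\<lambda>t. F (x + t *\<^sub>R h)) has_derivative (\<lambda>u. grad F (x + t *\<^sub>R h) \<bullet> (u *\<^sub>R h))) (at t)"
      by (rule has_derivative_compose[where f = "\<lambda>t. x + t *\<^sub>R h", OF _ grad_has_derivative[OF diff]])
        (auto intro!: derivative_eq_intros)
    then have "((\<lambda>t. F (x + t *\<^sub>R h)) has_real_derivative grad F (x + t *\<^sub>R h) \<bullet> h) (at t)"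
      by (simp add: has_field_derivative_def mult_commute_abs)
    then show ?thesis
      unfolding \<phi>_def \<phi>'_def by (auto intro!: derivative_eq_intros)
  qed
  have "\<phi>' t \<le> 0" if "0 \<le> t" for t
  proof -
    have "norm (grad F (x + t *\<^sub>R h) - grad F x) \<le> L * (t * norm h)"
      using lipschitz_onD[OF lip, of "x + t *\<^sub>R h" x] that by (simp add: dist_norm)
    then have "(grad F (x + t *\<^sub>R h) - grad F x) \<bullet> h \<le> L * (t * norm h) * norm h"
      by (meson mult_right_mono norm_cauchy_schwarz norm_ge_zero order_trans)
    then show ?thesis
      by (simp add: \<phi>'_def inner_diff_left power2_eq_square algebra_simps)
  qed
  then have "\<phi> 1 \<le> \<phi> 0"
    using deriv by (intro DERIV_nonpos_imp_nonincreasing[of 0 1 \<phi>]) auto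
  then show ?thesis
    by (simp add: \<phi>_def)
qed

lemma loewner_le_quadratic_form:
  assumes "A \<preceq> B"
  shows "x \<bullet> (A *v x) \<le> x \<bullet> (B *v x)"
  using assms
  by (auto simp: loewner_le_def positive_semidefinite_def matrix_vector_mult_diff_rdistrib
      inner_diff_right)

lemma scaled_identity_mult_vector: "(c *\<^sub>R mat 1 :: real^'n^'n) *v x = c *\<^sub>R x"
  by (simp flip: scaleR_matrix_vector_assoc)

text \<open>Testing positivity of \<open>A\<close> on (c I - A) x replaces an eigenvalue argument:
  it gives 0 \<le> c^2 A - 2 c A^2 + A^3 as quadratic forms at x. Bounding A by c I in the first and
  last term leaves c A^2 \<le> c^3 I.\<close>

lemma norm_mult_vector_le_of_loewner:
  fixes A :: "real^'n^'n"
  assumes psd: "positive_semidefinite A" and le: "A \<preceq> c *\<^sub>R mat 1" and "0 < c"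
  shows "(norm (A *v x))\<^sup>2 \<le> c\<^sup>2 * (norm x)\<^sup>2"
proof -
  let ?u = "A *v x"
  have upper: "z \<bullet> (A *v z) \<le> c * (norm z)\<^sup>2" for z
    using loewner_le_quadratic_form[OF le, of z]
    by (simp add: scaled_identity_mult_vector power2_norm_eq_inner)
  \<comment> \<open>Symmetry of \<open>A\<close> moves one factor across the inner product; this
    evaluates both mixed terms in the expansion below.\<close>
  have sym: "x \<bullet> (A *v ?u) = (norm ?u)\<^sup>2"
    using psd unfolding positive_semidefinite_def
    by (metis dot_lmul_matrix inner_commute power2_norm_eq_inner transpose_matrix_vector)
  have "0 \<le> (c *\<^sub>R x - ?u) \<bullet> (A *v (c *\<^sub>R x - ?u))"
    using psd by (simp add: positive_semidefinite_def)
  also have "\<dots> = c\<^sup>2 * (x \<bullet> ?u) - 2 * c * (norm ?u)\<^sup>2 + ?u \<bullet> (A *v ?u)"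
    using sym
    by (simp add: matrix_vector_mult_diff_distrib matrix_vector_mult_scaleR inner_diff_left
        inner_diff_right power2_norm_eq_inner power2_eq_square[of c] algebra_simps)
  also have "\<dots> \<le> c\<^sup>2 * (c * (norm x)\<^sup>2) - 2 * c * (norm ?u)\<^sup>2 + c * (norm ?u)\<^sup>2"
    using upper \<open>0 < c\<close> by (intro add_mono diff_mono mult_left_mono) auto
  finally have "c * (norm ?u)\<^sup>2 \<le> c * (c\<^sup>2 * (norm x)\<^sup>2)"
    by (simp add: algebra_simps)
  then show ?thesis
    using \<open>0 < c\<close> by simp
qed

text \<open>The order only speaks of the difference, so symmetry of \<open>A\<close> has to be
  recovered from that of \<open>A - c *\<^sub>R mat 1\<close>.\<close>

lemma positive_semidefinite_of_loewner:
  assumes "c *\<^sub>R mat 1 \<preceq> A" and "0 \<le> c"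
  shows "positive_semidefinite A"
proof -
  have "transpose (A - c *\<^sub>R mat 1) = transpose A - c *\<^sub>R mat 1"
    by (simp add: transpose_def vec_eq_iff mat_def)
  then have "transpose A = A"
    using assms(1) by (simp add: loewner_le_def positive_semidefinite_def)
  moreover have "0 \<le> x \<bullet> (A *v x)" for x
    using loewner_le_quadratic_form[OF assms(1), of x] \<open>0 \<le> c\<close>
    by (simp add: scaled_identity_mult_vector)
      (meson inner_ge_zero mult_nonneg_nonneg order_trans)
  ultimately show ?thesis
    by (simp add: positive_semidefinite_def)
qed

text \<open>The lower bound on \<open>H\<close> controls the linear term of the descent lemma, the
  upper bound controls the quadratic one, and the step-size condition lets the quadratic term cancel
  at most half of the linear gain.\<close>

lemma sufficient_decrease:
  fixes F :: "real^'n \<Rightarrow> real"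
  assumes diff: "\<And>x. F differentiable (at x)" and lip: "L-lipschitz_on UNIV (grad F)" and "0 < L"
    and "0 < \<mu>\<^sub>1" and "\<mu>\<^sub>1 \<le> \<mu>\<^sub>2"
    and lower: "\<mu>\<^sub>1 *\<^sub>R mat 1 \<preceq> H" and upper: "H \<preceq> \<mu>\<^sub>2 *\<^sub>R mat 1"
    and "0 < \<alpha>" and step: "\<alpha> \<le> \<mu>\<^sub>1 / (\<mu>\<^sub>2\<^sup>2 * L)"
  shows "F (x - \<alpha> *\<^sub>R (H *v grad F x)) \<le> F x - \<alpha> * \<mu>\<^sub>1 / 2 * (norm (grad F x))\<^sup>2"
proof -
  let ?g = "grad F x"
  let ?h = "- (\<alpha> *\<^sub>R (H *v ?g))"
  have "\<mu>\<^sub>1 * (norm ?g)\<^sup>2 \<le> ?g \<bullet> (H *v ?g)"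
    using loewner_le_quadratic_form[OF lower, of ?g]
    by (simp add: scaled_identity_mult_vector power2_norm_eq_inner)
  then have first_order: "?g \<bullet> ?h \<le> - (\<alpha> * (\<mu>\<^sub>1 * (norm ?g)\<^sup>2))"
    using \<open>0 < \<alpha>\<close> by simp
  have "positive_semidefinite H"
    using positive_semidefinite_of_loewner[OF lower] \<open>0 < \<mu>\<^sub>1\<close> by simp
  then have "(norm (H *v ?g))\<^sup>2 \<le> \<mu>\<^sub>2\<^sup>2 * (norm ?g)\<^sup>2"
    using norm_mult_vector_le_of_loewner upper \<open>0 < \<mu>\<^sub>1\<close> \<open>\<mu>\<^sub>1 \<le> \<mu>\<^sub>2\<close> by (metis less_le_trans)
  then have "L / 2 * (norm ?h)\<^sup>2 \<le> L / 2 * (\<alpha>\<^sup>2 * (\<mu>\<^sub>2\<^sup>2 * (norm ?g)\<^sup>2))"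
    using \<open>0 < L\<close> by (simp add: power_mult_distrib mult_left_mono)
  \<comment> \<open>Grouped so that the last factor is the one the step-size condition bounds by
    \<open>\<mu>\<^sub>1\<close>.\<close>
  also have "\<dots> = \<alpha> / 2 * (norm ?g)\<^sup>2 * (\<alpha> * (\<mu>\<^sub>2\<^sup>2 * L))"
    by (simp add: power2_eq_square)
  also have "\<dots> \<le> \<alpha> / 2 * (norm ?g)\<^sup>2 * \<mu>\<^sub>1"
  proof (rule mult_left_mono)
    have "0 < \<mu>\<^sub>2\<^sup>2 * L"
      using \<open>0 < L\<close> \<open>0 < \<mu>\<^sub>1\<close> \<open>\<mu>\<^sub>1 \<le> \<mu>\<^sub>2\<close> by simp
    then show "\<alpha> * (\<mu>\<^sub>2\<^sup>2 * L) \<le> \<mu>\<^sub>1"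
      using step by (simp only: pos_le_divide_eq)
  qed (use \<open>0 < \<alpha>\<close> in simp)
  finally have "L / 2 * (norm ?h)\<^sup>2 \<le> \<alpha> / 2 * (norm ?g)\<^sup>2 * \<mu>\<^sub>1" .
  with first_order descent_lemma[OF diff lip, of x ?h] show ?thesis
    by (simp add: algebra_simps)
qed

theorem theorem5p5:
  fixes F :: "real^'n \<Rightarrow> real" and Fhat L \<epsilon> r \<mu>\<^sub>1 \<mu>\<^sub>2 \<alpha> :: real and m :: nat
    and opt :: pair_rule and a :: "nat \<Rightarrow> real"
    and \<sigma> :: "nat \<Rightarrow> nat \<Rightarrow> real^'n" and l :: "nat \<Rightarrow> nat" and w :: "nat \<Rightarrow> real^'n"
    and w\<^sub>0 :: "real^'n"
  assumes "twice_continuously_differentiable F"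
    and "\<And>x. Fhat \<le> F x"
    and "0 < L" and "L-lipschitz_on UNIV (grad F)"
    and "0 < \<epsilon>" and "1 \<le> m" and "0 < r"
    and "w 0 = w\<^sub>0" and "slbfgs_run opt F m r \<epsilon> a \<sigma> l w"
    and "0 < \<mu>\<^sub>1" and "\<mu>\<^sub>1 \<le> \<mu>\<^sub>2"
    and "\<And>k. \<mu>\<^sub>1 *\<^sub>R mat 1 \<preceq> slbfgs_H opt F m r \<epsilon> (\<sigma> k) (l k) (w k)"
    and "\<And>k. slbfgs_H opt F m r \<epsilon> (\<sigma> k) (l k) (w k) \<preceq> \<mu>\<^sub>2 *\<^sub>R mat 1"
    and "\<And>k. a k = \<alpha>" and "0 < \<alpha>" and "\<alpha> \<le> \<mu>\<^sub>1 / (\<mu>\<^sub>2\<^sup>2 * L)"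
  shows "((\<lambda>k. norm (grad F (w k))) \<longlonglongrightarrow> 0) \<and>
    (\<forall>T::nat. T > 1 \<longrightarrow>
       (1 / real T) * (\<Sum>k=0..T-1. (norm (grad F (w k)))\<^sup>2)
         \<le> 2 * (F w\<^sub>0 - Fhat) / (\<alpha> * \<mu>\<^sub>1 * real T)) \<and>
    ((\<lambda>T. 2 * (F w\<^sub>0 - Fhat) / (\<alpha> * \<mu>\<^sub>1 * real T)) \<longlonglongrightarrow> 0)"
proof -
  let ?g = "\<lambda>k. (norm (grad F (w k)))\<^sup>2"
  have c: "0 < \<alpha> * \<mu>\<^sub>1"
    using \<open>0 < \<alpha>\<close> \<open>0 < \<mu>\<^sub>1\<close> by simp
  have diff: "F differentiable (at x)" for x
    using assms(1) by (simp add: twice_continuously_differentiable_def)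
  have decrease: "F (w (Suc k)) \<le> F (w k) - \<alpha> * \<mu>\<^sub>1 / 2 * ?g k" for k
  proof -
    have "w (Suc k) = w k - \<alpha> *\<^sub>R (slbfgs_H opt F m r \<epsilon> (\<sigma> k) (l k) (w k) *v grad F (w k))"
      using assms(9,14) by (simp add: slbfgs_run_def)
    then show ?thesis
      using sufficient_decrease[OF diff assms(4,3,10,11,12,13,15,16)] by simp
  qed
  \<comment> \<open>Keeping \<open>F (w n)\<close> on the right makes the induction close;
    \<open>Fhat\<close> replaces it only afterwards.\<close>
  have telescope: "\<alpha> * \<mu>\<^sub>1 / 2 * sum ?g {..<n} \<le> F w\<^sub>0 - F (w n)" for n
  proof (induction n)
    case 0
    then show ?case using assms(8) by simp
  next
    case (Suc n)
    then show ?case using decrease[of n] by (simp add: distrib_left)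
  qed
  \<comment> \<open>The bound is uniform in \<open>n\<close>, so it yields both summability, hence
    the limit, and the estimate of the averages.\<close>
  have sum_bound: "sum ?g {..<n} \<le> 2 * (F w\<^sub>0 - Fhat) / (\<alpha> * \<mu>\<^sub>1)" for n
    using telescope[of n] assms(2)[of "w n"] c by (simp add: pos_le_divide_eq algebra_simps)
  have "summable ?g"
    \<comment> \<open>The \<open>Suc\<close> turns sums over \<open>{..<n}\<close> into the sums
      over \<open>{..n}\<close> that the summability criterion expects.\<close>
    using sum_bound[of "Suc _"] unfolding lessThan_Suc_atMost
    by (rule bounded_imp_summable[rotated]) simp
  then have "?g \<longlonglongrightarrow> 0"
    by (rule summable_LIMSEQ_zero)
  from tendsto_real_sqrt[OF this] have "(\<lambda>k. norm (grad F (w k))) \<longlonglongrightarrow> 0"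
    by simp
  moreover have "(1 / real T) * (\<Sum>k=0..T-1. ?g k) \<le> 2 * (F w\<^sub>0 - Fhat) / (\<alpha> * \<mu>\<^sub>1 * real T)"
    if "T > 1" for T
  proof -
    \<comment> \<open>Subtraction on naturals truncates, so this would fail for
      \<open>T = 0\<close>.\<close>
    have "{0..T-1} = {..<T}"
      using that by auto
    then have "(1 / real T) * (\<Sum>k=0..T-1. ?g k) \<le> 1 / real T * (2 * (F w\<^sub>0 - Fhat) / (\<alpha> * \<mu>\<^sub>1))"
      using sum_bound[of T] by (simp only: mult_left_mono of_nat_0_le_iff zero_le_divide_1_iff)
    then show ?thesis
      by (simp add: mult.commute)
  qed
  moreover have "(\<lambda>T. 2 * (F w\<^sub>0 - Fhat) / (\<alpha> * \<mu>\<^sub>1 * real T)) \<longlonglongrightarrow> 0"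
    using tendsto_mult[OF tendsto_const[of "2 * (F w\<^sub>0 - Fhat) / (\<alpha> * \<mu>\<^sub>1)"] lim_1_over_n]
    by simp
  ultimately show ?thesis
    by blast
qed

end
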